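(* Let $m,k\in\mathbb{N}$ with $1\le k<2m$, and let $a>0$. For $n\ge 0$ let $r_{m,k}(n)=\#\{(x_1,\dots,x_k)\in\mathbb{Z}^k : x_1^{2m}+\cdots+x_k^{2m}=n\}$, and for $z>0$ let $U_{2m}(z)=\sum_{t\in\mathbb{Z}}\frac{1}{t^{2m}+z^{2m}}$. Then \[ \sum_{n=0}^{\infty}\frac{r_{m,k}(n)}{n+a}\;\ge\;a^{\,k-1}\left[U_{2m}\!\left(a^{1/(2m)}\right)\right]^k. \]
   Context: $\mathbb{N}$ denotes the positive integers. $r_{m,k}(n)$ counts representations of $n$ as a sum of $k$ $(2m)$-th powers of integers (signs and order counted). $U_{2m}$ is called the generalized cotangent series. *)

theory Defs
  imports "HOL-Analysis.Analysis"
begin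

definition rep_count :: "nat \<Rightarrow> nat \<Rightarrow> nat \<Rightarrow> nat" where
  "rep_count m k n =
     card {xs :: int list. length xs = k \<and> (\<Sum>x\<leftarrow>xs. x ^ (2 * m)) = int n}"

definition gen_cot_series :: "nat \<Rightarrow> real \<Rightarrow> real" where
  "gen_cot_series q z = (\<Sum>\<^sub>\<infinity>t::int. 1 / (of_int t ^ q + z ^ q))"

text \<open>
  Both \<^const>\<open>card\<close> and the infinite sum are totalised in HOL (value 0 on infinite sets and
  non-summable families). The following two facts show that these default values are never used
  for positive \<open>m\<close> and \<open>z\<close>.
\<close>

lemma finite_rep_count:
  assumes "m \<ge> 1"
  shows "finite {xs :: int list. length xs = k \<and> (\<Sum>x\<leftarrow>xs. x ^ (2 * m)) = int n}"
proof (rule finite_subset)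
  show "finite {xs :: int list. set xs \<subseteq> {- int n..int n} \<and> length xs = k}"
    by (rule finite_lists_length_eq) simp
  show "{xs :: int list. length xs = k \<and> (\<Sum>x\<leftarrow>xs. x ^ (2 * m)) = int n}
          \<subseteq> {xs. set xs \<subseteq> {- int n..int n} \<and> length xs = k}"
  proof safe
    fix xs :: "int list" and x
    assume s: "(\<Sum>x\<leftarrow>xs. x ^ (2 * m)) = int n" and x: "x \<in> set xs"
    have "x ^ (2 * m) \<le> (\<Sum>x\<leftarrow>xs. x ^ (2 * m))"
      by (rule member_le_sum_list) (use x in \<open>auto simp: power_mult\<close>)
    moreover have "\<bar>x\<bar> \<le> x ^ (2 * m)"
    proof (cases "x = 0")
      case False
      then have "\<bar>x\<bar> ^ 1 \<le> \<bar>x\<bar> ^ (2 * m)"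
        using assms by (intro power_increasing) auto
      then show ?thesis by (simp add: power_even_abs)
    qed auto
    ultimately show "x \<in> {- int n..int n}" using s by auto
  qed
qed

lemma summable_gen_cot_series:
  fixes z :: real
  assumes "m \<ge> 1" "z > 0"
  shows "(\<lambda>t::int. 1 / (of_int t ^ (2 * m) + z ^ (2 * m))) summable_on UNIV"
proof -
  define f where "f = (\<lambda>t::int. 1 / (of_int t ^ (2 * m) + z ^ (2 * m)))"
  have nn: "f t \<ge> 0" for t
    using assms unfolding f_def by (simp add: power_mult)
  have bound: "f (int n) \<le> 1 / real n ^ 2" if "n \<ge> 1" for n
  proof -
    have "real n ^ 2 \<le> real n ^ (2 * m)"
      using assms that by (intro power_increasing) auto
    also have "\<dots> \<le> real n ^ (2 * m) + z ^ (2 * m)" using assms by simp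
    finally show ?thesis
      unfolding f_def using that by (intro divide_left_mono mult_pos_pos add_pos_pos)
        (use assms in auto)
  qed
  have "summable (\<lambda>n. f (int n))"
  proof (rule summable_comparison_test)
    show "summable (\<lambda>n. 1 / real n ^ 2)"
      using inverse_power_summable[of 2, where ?'a = real] by (simp add: inverse_eq_divide)
    show "\<exists>N. \<forall>n\<ge>N. norm (f (int n)) \<le> 1 / real n ^ 2"
      using bound nn by (intro exI[of _ 1]) auto
  qed
  then have "(\<lambda>n. f (int n)) summable_on UNIV"
    using nn by (intro summable_nonneg_imp_summable_on) auto
  then have pos: "f summable_on range int"
    by (subst summable_on_reindex) (auto simp: o_def)
  have "f \<circ> uminus = f" by (auto simp: f_def)
  then have neg: "f summable_on uminus ` range int"
    using pos by (subst summable_on_reindex) auto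
  have "f summable_on (range int \<union> uminus ` range int)"
    using pos neg by (rule summable_on_union)
  also have "range int \<union> uminus ` range int = UNIV"
    by (metis (no_types, lifting) UNIV_eq_I UnCI image_eqI int_cases2 rangeI)
  finally show ?thesis unfolding f_def .
qed

end

theory Submission
  imports Defs "HOL-Library.NList"
begin

text \<open>
  The left-hand side is the sum of \<open>1 / (x\<^sub>1\<^sup>2\<^sup>m + \<dots> + x\<^sub>k\<^sup>2\<^sup>m + a)\<close> over all integer vectors, grouped by
  the value \<open>n\<close> of the form; the right-hand side is the sum of
  \<open>a\<^sup>k\<^sup>-\<^sup>1 / ((x\<^sub>1\<^sup>2\<^sup>m + a) \<dots> (x\<^sub>k\<^sup>2\<^sup>m + a))\<close> over the same vectors. The latter terms are smaller because
  expanding \<open>(y\<^sub>1 + a) \<dots> (y\<^sub>k + a)\<close> with \<open>y\<^sub>i \<ge> 0\<close> gives at least \<open>a\<^sup>k\<^sup>-\<^sup>1 (y\<^sub>1 + \<dots> + y\<^sub>k + a)\<close>.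
  For convergence, \<open>y\<^sub>1 + \<dots> + y\<^sub>k + a\<close> dominates each \<open>y\<^sub>i + a\<close>, hence also their geometric mean, so
  the left-hand side is at most the \<open>k\<close>-th power of the sum of \<open>(t\<^sup>2\<^sup>m + a)\<^sup>-\<^sup>1\<^sup>/\<^sup>k\<close> over the integers
  \<open>t\<close>, which is finite since \<open>2m/k > 1\<close>.
\<close>

lemma has_sum_prod_list_nlists:
  fixes g :: "'a \<Rightarrow> real"
  assumes g: "(g has_sum S) A" and nonneg: "\<And>x. x \<in> A \<Longrightarrow> g x \<ge> 0"
  shows "((\<lambda>xs. \<Prod>x\<leftarrow>xs. g x) has_sum S ^ k) (nlists k A)"
proof (induction k)
  case 0
  show ?case by (auto intro: has_sum_finiteI)
next
  case (Suc k)
  let ?f = "\<lambda>(x, xs). g x * (\<Prod>x\<leftarrow>xs. g x)"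
  have inner: "((\<lambda>xs. ?f (x, xs)) has_sum g x * S ^ k) (nlists k A)" for x
    using has_sum_cmult_right[OF Suc.IH, of "g x"] by simp
  have outer: "((\<lambda>x. g x * S ^ k) has_sum S * S ^ k) A"
    by (rule has_sum_cmult_left[OF g])
  have "?f (x, xs) \<ge> 0" if "x \<in> A" "xs \<in> nlists k A" for x xs
    using that nonneg unfolding nlists_def subset_iff
    by (auto intro!: mult_nonneg_nonneg prod_list_nonneg)
  then have "?f summable_on A \<times> nlists k A"
    by (rule summable_on_SigmaI[OF inner has_sum_imp_summable[OF outer]])
  then have "(?f has_sum S * S ^ k) (A \<times> nlists k A)"
    by (rule has_sum_SigmaI[OF inner outer])
  moreover have "nlists (Suc k) A = (\<lambda>(x, xs). x # xs) ` (A \<times> nlists k A)"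
    by (auto simp: nlists_Suc)
  moreover have "inj_on (\<lambda>(x, xs). x # xs) (A \<times> nlists k A)"
    by (auto simp: inj_on_def)
  ultimately show ?case
    by (simp add: has_sum_reindex o_def case_prod_unfold)
qed

lemma has_sum_card_fibers:
  fixes g :: "'b \<Rightarrow> 'c :: {topological_comm_monoid_add, t3_space, semiring_1}"
  assumes sum: "((\<lambda>x. g (h x)) has_sum S) A"
    and finite: "\<And>y. finite {x \<in> A. h x = y}"
  shows "((\<lambda>y. of_nat (card {x \<in> A. h x = y}) * g y) has_sum S) UNIV"
proof -
  let ?fib = "\<lambda>y. {x \<in> A. h x = y}"
  have "A = snd ` Sigma UNIV ?fib" and "inj_on snd (Sigma UNIV ?fib)"
    by (force, auto simp: inj_on_def)
  then have "((\<lambda>(y, x). g (h x)) has_sum S) (Sigma UNIV ?fib)"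
    using sum has_sum_reindex[of snd "Sigma UNIV ?fib" "\<lambda>x. g (h x)" S]
    by (simp add: o_def case_prod_unfold)
  then show ?thesis
    by (rule has_sum_SigmaD) (auto intro!: has_sum_finiteI finite)
qed

lemma has_sum_rep_count:
  fixes g :: "real \<Rightarrow> 'c :: {topological_comm_monoid_add, t3_space, semiring_1}"
  assumes "m \<ge> 1"
    and sum: "((\<lambda>xs. g (\<Sum>x\<leftarrow>xs. of_int x ^ (2 * m))) has_sum S) (nlists k UNIV)"
  shows "((\<lambda>n. of_nat (rep_count m k n) * g (real n)) has_sum S) UNIV"
proof -
  define N where "N xs = nat (\<Sum>x\<leftarrow>xs. x ^ (2 * m))" for xs :: "int list"
  have nonneg: "(\<Sum>x\<leftarrow>xs. x ^ (2 * m)) \<ge> 0" for xs :: "int list"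
    by (intro sum_list_nonneg) (auto simp: power_mult)
  have real_N: "real (N xs) = (\<Sum>x\<leftarrow>xs. of_int x ^ (2 * m))" for xs
    using nonneg[of xs] by (simp add: N_def o_def flip: sum_list_of_int)
  have fiber: "{xs \<in> nlists k UNIV. N xs = n}
      = {xs. length xs = k \<and> (\<Sum>x\<leftarrow>xs. x ^ (2 * m)) = int n}" for n
    using nonneg by (auto simp: N_def in_nlists_UNIV)
  have "((\<lambda>xs. g (real (N xs))) has_sum S) (nlists k UNIV)"
    using sum by (simp add: real_N)
  then have "((\<lambda>n. of_nat (card {xs \<in> nlists k UNIV. N xs = n}) * g (real n)) has_sum S) UNIV"
    by (rule has_sum_card_fibers) (simp add: fiber finite_rep_count[OF \<open>m \<ge> 1\<close>])
  then show ?thesis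
    by (simp add: fiber rep_count_def)
qed

lemma power_length_le_prod_list:
  fixes c :: "'a :: linordered_semidom"
  assumes "c \<ge> 0" and "\<And>x. x \<in> set xs \<Longrightarrow> c \<le> f x"
  shows "c ^ length xs \<le> (\<Prod>x\<leftarrow>xs. f x)"
  using assms(2)
proof (induction xs)
  case (Cons x xs)
  then show ?case
    using \<open>c \<ge> 0\<close> by (auto intro!: mult_mono intro: order.trans)
qed simp

lemma inverse_sum_list_le_prod_list_powr:
  fixes a :: real
  assumes "a > 0" and "xs \<noteq> []" and nonneg: "\<And>x. x \<in> set xs \<Longrightarrow> f x \<ge> 0"
  shows "1 / ((\<Sum>x\<leftarrow>xs. f x) + a) \<le> (\<Prod>x\<leftarrow>xs. (f x + a) powr - (1 / real (length xs)))"
proof -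
  define s where "s = (\<Sum>x\<leftarrow>xs. f x) + a"
  have "s > 0"
    unfolding s_def using nonneg \<open>a > 0\<close> by (intro add_nonneg_pos sum_list_nonneg) auto
  have "1 / s = s powr - 1"
    using \<open>s > 0\<close> by (simp add: powr_minus_divide)
  also have "\<dots> = (s powr - (1 / real (length xs))) ^ length xs"
    using \<open>s > 0\<close> \<open>xs \<noteq> []\<close> by (simp add: powr_powr flip: powr_realpow)
  also have "\<dots> \<le> (\<Prod>x\<leftarrow>xs. (f x + a) powr - (1 / real (length xs)))"
  proof (rule power_length_le_prod_list)
    fix x assume x: "x \<in> set xs"
    then have "f x + a \<le> s"
      unfolding s_def using nonneg by (auto intro!: member_le_sum_list)
    then show "s powr - (1 / real (length xs)) \<le> (f x + a) powr - (1 / real (length xs))"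
      using nonneg[OF x] \<open>a > 0\<close> by (intro powr_mono2') auto
  qed simp
  finally show ?thesis by (simp add: s_def)
qed

lemma power_mult_prod_list_inverse_le:
  fixes a :: "'a :: linordered_field"
  assumes "a > 0" and "xs \<noteq> []" and "\<And>x. x \<in> set xs \<Longrightarrow> f x \<ge> 0"
  shows "a ^ (length xs - 1) * (\<Prod>x\<leftarrow>xs. 1 / (f x + a)) \<le> 1 / ((\<Sum>x\<leftarrow>xs. f x) + a)"
  using assms(2,3)
proof (induction xs rule: list_nonempty_induct)
  case (cons x xs)
  define s where "s = (\<Sum>x\<leftarrow>xs. f x)"
  have nonneg: "f x \<ge> 0" "s \<ge> 0"
    using cons.prems by (auto simp: s_def intro!: sum_list_nonneg)
  have "a ^ (length (x # xs) - 1) * (\<Prod>x\<leftarrow>x # xs. 1 / (f x + a))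
      = a / (f x + a) * (a ^ (length xs - 1) * (\<Prod>x\<leftarrow>xs. 1 / (f x + a)))"
    using \<open>xs \<noteq> []\<close> by (simp add: power_eq_if)
  also have "\<dots> \<le> a / (f x + a) * (1 / (s + a))"
    using cons nonneg \<open>a > 0\<close> unfolding s_def by (intro mult_left_mono) auto
  also have "\<dots> \<le> 1 / (f x + s + a)"
  proof -
    have "a * (f x + s + a) \<le> (f x + a) * (s + a)"
      using nonneg by (simp add: algebra_simps)
    then show ?thesis
      using nonneg \<open>a > 0\<close> by (simp add: divide_simps add_nonneg_pos)
  qed
  finally show ?case by (simp add: s_def)
qed simp

lemma summable_on_inverse_sum_list:
  fixes f :: "'a \<Rightarrow> real"
  assumes "a > 0" and "k \<ge> 1" and nonneg: "\<And>x. x \<in> A \<Longrightarrow> f x \<ge> 0"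
    and summable: "(\<lambda>x. (f x + a) powr - (1 / real k)) summable_on A"
  shows "(\<lambda>xs. 1 / ((\<Sum>x\<leftarrow>xs. f x) + a)) summable_on nlists k A"
proof (rule summable_on_comparison_test)
  show "(\<lambda>xs. \<Prod>x\<leftarrow>xs. (f x + a) powr - (1 / real k)) summable_on nlists k A"
    using has_sum_prod_list_nlists[OF has_sum_infsum[OF summable]]
    by (auto intro: has_sum_imp_summable)
next
  fix xs assume "xs \<in> nlists k A"
  then have xs: "length xs = k" "xs \<noteq> []" "\<And>x. x \<in> set xs \<Longrightarrow> f x \<ge> 0"
    using nonneg \<open>k \<ge> 1\<close> unfolding nlists_def by auto
  then show "1 / ((\<Sum>x\<leftarrow>xs. f x) + a) \<le> (\<Prod>x\<leftarrow>xs. (f x + a) powr - (1 / real k))"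
    using inverse_sum_list_le_prod_list_powr[of a xs f] \<open>a > 0\<close> by auto
  show "0 \<le> 1 / ((\<Sum>x\<leftarrow>xs. f x) + a)"
    using xs(3) \<open>a > 0\<close> by (auto intro!: divide_nonneg_nonneg add_nonneg_nonneg sum_list_nonneg)
qed

lemma power_infsum_inverse_le_infsum_inverse_sum_list:
  fixes f :: "'a \<Rightarrow> real"
  assumes "a > 0" and "k \<ge> 1" and nonneg: "\<And>x. x \<in> A \<Longrightarrow> f x \<ge> 0"
    and summable: "(\<lambda>x. 1 / (f x + a)) summable_on A"
    and summable_nlists: "(\<lambda>xs. 1 / ((\<Sum>x\<leftarrow>xs. f x) + a)) summable_on nlists k A"
  shows "a ^ (k - 1) * (\<Sum>\<^sub>\<infinity>x\<in>A. 1 / (f x + a)) ^ k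
    \<le> (\<Sum>\<^sub>\<infinity>xs\<in>nlists k A. 1 / ((\<Sum>x\<leftarrow>xs. f x) + a))"
proof (rule has_sum_mono)
  show "((\<lambda>xs. a ^ (k - 1) * (\<Prod>x\<leftarrow>xs. 1 / (f x + a))) has_sum
      a ^ (k - 1) * (\<Sum>\<^sub>\<infinity>x\<in>A. 1 / (f x + a)) ^ k) (nlists k A)"
    using nonneg \<open>a > 0\<close>
    by (intro has_sum_cmult_right has_sum_prod_list_nlists has_sum_infsum[OF summable])
      (auto intro!: divide_nonneg_nonneg add_nonneg_nonneg)
  show "((\<lambda>xs. 1 / ((\<Sum>x\<leftarrow>xs. f x) + a)) has_sum
      (\<Sum>\<^sub>\<infinity>xs\<in>nlists k A. 1 / ((\<Sum>x\<leftarrow>xs. f x) + a))) (nlists k A)"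
    by (rule has_sum_infsum[OF summable_nlists])
next
  fix xs assume "xs \<in> nlists k A"
  then have "length xs = k" "xs \<noteq> []" "\<And>x. x \<in> set xs \<Longrightarrow> f x \<ge> 0"
    using nonneg \<open>k \<ge> 1\<close> unfolding nlists_def by auto
  then show "a ^ (k - 1) * (\<Prod>x\<leftarrow>xs. 1 / (f x + a)) \<le> 1 / ((\<Sum>x\<leftarrow>xs. f x) + a)"
    using power_mult_prod_list_inverse_le[of a xs f] \<open>a > 0\<close> by auto
qed

lemma summable_on_int_of_summable_on_nat:
  fixes f :: "int \<Rightarrow> 'a :: {uniform_topological_group_add, topological_comm_monoid_add,
    ab_group_add, complete_uniform_space}"
  assumes nonneg_part: "(\<lambda>n. f (int n)) summable_on UNIV"
    and nonpos_part: "(\<lambda>n. f (- int n)) summable_on UNIV"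
  shows "f summable_on UNIV"
proof -
  have "f summable_on range int" "f summable_on range (\<lambda>n. - int n)"
    using assms by (auto simp: summable_on_reindex inj_on_def o_def)
  then have "f summable_on range int \<union> range (\<lambda>n. - int n)"
    by (rule summable_on_union)
  moreover have "t \<in> range int \<union> range (\<lambda>n. - int n)" for t
    by (cases t rule: int_cases2) auto
  then have "range int \<union> range (\<lambda>n. - int n) = UNIV" by blast
  ultimately show ?thesis by simp
qed

lemma summable_on_int_even_power_powr:
  fixes a p :: real
  assumes "a \<ge> 0" and "even q" and "real q * p > 1"
  shows "(\<lambda>t::int. (of_int t ^ q + a) powr - p) summable_on UNIV"
proof -
  have "p > 0"
    using \<open>real q * p > 1\<close> by (smt (verit) mult_nonneg_nonpos of_nat_0_le_iff)
  have bound: "(real n ^ q + a) powr - p \<le> real n powr - (real q * p)" if "n \<ge> 1" for n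
  proof -
    have "(real n ^ q + a) powr - p \<le> (real n ^ q) powr - p"
      using \<open>a \<ge> 0\<close> \<open>p > 0\<close> that by (intro powr_mono2') auto
    also have "\<dots> = real n powr - (real q * p)"
      using that by (simp add: powr_powr flip: powr_realpow)
    finally show ?thesis .
  qed
  have "summable (\<lambda>n. (real n ^ q + a) powr - p)"
  proof (rule summable_comparison_test)
    show "summable (\<lambda>n. real n powr - (real q * p))"
      using \<open>real q * p > 1\<close> by (simp add: summable_real_powr_iff)
    show "\<exists>N. \<forall>n\<ge>N. norm ((real n ^ q + a) powr - p) \<le> real n powr - (real q * p)"
      using bound by (intro exI[of _ 1]) auto
  qed
  then have "(\<lambda>n. (real n ^ q + a) powr - p) summable_on UNIV"
    by (intro summable_nonneg_imp_summable_on) auto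
  then show ?thesis
    using \<open>even q\<close> by (intro summable_on_int_of_summable_on_nat) simp_all
qed

theorem theorem3p1:
  fixes m k :: nat and a :: real
  assumes "1 \<le> m" and "1 \<le> k" and "k < 2 * m" and "a > 0"
  shows "summable (\<lambda>n. real (rep_count m k n) / (real n + a)) \<and>
    (\<Sum>n. real (rep_count m k n) / (real n + a))
      \<ge> a ^ (k - 1) * gen_cot_series (2 * m) (a powr (1 / (2 * real m))) ^ k"
proof -
  define z where "z = a powr (1 / (2 * real m))"
  define F where "F xs = 1 / ((\<Sum>x\<leftarrow>xs. real_of_int x ^ (2 * m)) + a)" for xs
  have z: "z > 0" "z ^ (2 * m) = a"
    using assms by (auto simp: z_def powr_powr simp flip: powr_realpow)
  have "real (2 * m) * (1 / real k) > 1"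
    using \<open>1 \<le> k\<close> \<open>k < 2 * m\<close> by (simp del: of_nat_mult)
  then have "(\<lambda>t::int. (of_int t ^ (2 * m) + a) powr - (1 / real k)) summable_on UNIV"
    using \<open>a > 0\<close> by (intro summable_on_int_even_power_powr) auto
  then have F_summable: "F summable_on nlists k UNIV"
    unfolding F_def using assms by (intro summable_on_inverse_sum_list) auto
  then have "((\<lambda>n. real (rep_count m k n) * (1 / (real n + a)))
      has_sum infsum F (nlists k UNIV)) UNIV"
    unfolding F_def by (intro has_sum_rep_count[OF \<open>1 \<le> m\<close>] has_sum_infsum)
  then have "(\<lambda>n. real (rep_count m k n) / (real n + a)) sums infsum F (nlists k UNIV)"
    by (auto dest: has_sum_imp_sums)
  moreover have "a ^ (k - 1) * gen_cot_series (2 * m) z ^ k \<le> infsum F (nlists k UNIV)"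
    using F_summable summable_gen_cot_series[OF \<open>1 \<le> m\<close> \<open>z > 0\<close>] assms
    unfolding gen_cot_series_def F_def z(2)
    by (intro power_infsum_inverse_le_infsum_inverse_sum_list) auto
  ultimately show ?thesis
    by (simp add: sums_iff z_def)
qed

end
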